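(* Let $P_n$ and $P_m$ be path graphs with $n$ and $m$ vertices, respectively. Suppose $(d_{P_n},x)$ is an arithmetical structure on $P_n$ and $(d_{P_m},y)$ is an arithmetical structure on $P_m$, with $x\in\mathbb Z_{>0}^n$, $y\in\mathbb Z_{>0}^m$, so that $$M_{P_n}x=(\operatorname{diag}(d_{P_n})-A(P_n))x=0,\qquad M_{P_m}y=(\operatorname{diag}(d_{P_m})-A(P_m))y=0.$$ Then an arithmetical structure $(d,\mathbf r)$ on the Cartesian product $P_n\square P_m$ is given by $$\mathbf r=x\otimes y\in\mathbb Z_{>0}^{nm},\qquad d(i,j)=d_{P_n,i}+d_{P_m,j}\quad (1\le i\le n,\ 1\le j\le m).$$ Equivalently, if $M_{P_n\square P_m}:=\operatorname{diag}(d)-A(P_n\square P_m)$, then $M_{P_n\square P_m}\,\mathbf r=0$.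
   Context: An arithmetical structure on a finite connected graph $G$ is a pair $(\mathbf d,\mathbf r)$ of vectors of positive integers indexed by the vertices of $G$ such that $\mathbf r$ is primitive (the gcd of its entries is $1$) and $(\operatorname{diag}(\mathbf d)-A(G))\mathbf r=0$, where $A(G)$ is the adjacency matrix of $G$. $P_n$ has vertex set $\{1,\dots,n\}$ and edges $\{i,i+1\}$, $1\le i<n$. The grid graph $P_n\square P_m$ has vertices $(i,j)$, $1\le i\le n$, $1\le j\le m$, with $(i,j)$ and $(k,\ell)$ adjacent iff ($i=k$ and $|j-\ell|=1$) or ($j=\ell$ and $|i-k|=1$). The Kronecker product $x\otimes y$ has entry $x_iy_j$ at the vertex $(i,j)$ (vertices ordered lexicographically). *)

theory Defs
  imports Main "Graph_Theory.Graph_Theory"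
begin

text \<open>
  A finite simple graph is a \<open>pair_graph\<close>: finitely many vertices and a symmetric, irreflexive set of
  arcs, each edge being present as two opposite arcs.  Vectors and matrices indexed by the vertices
  are functions on the vertex type; only their values at vertices matter.
\<close>

definition diag :: "('a \<Rightarrow> int) \<Rightarrow> 'a \<Rightarrow> 'a \<Rightarrow> int" where
  "diag d u v = (if u = v then d u else 0)"

definition adjacency_matrix :: "'a pair_pre_digraph \<Rightarrow> 'a \<Rightarrow> 'a \<Rightarrow> int" where
  "adjacency_matrix G u v = (if (u, v) \<in> parcs G then 1 else 0)"

definition arith_matrix :: "'a pair_pre_digraph \<Rightarrow> ('a \<Rightarrow> int) \<Rightarrow> 'a \<Rightarrow> 'a \<Rightarrow> int" where
  "arith_matrix G d u v = diag d u v - adjacency_matrix G u v"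

definition mat_vec :: "'a set \<Rightarrow> ('a \<Rightarrow> 'a \<Rightarrow> int) \<Rightarrow> ('a \<Rightarrow> int) \<Rightarrow> 'a \<Rightarrow> int" where
  "mat_vec V M r u = (\<Sum>v\<in>V. M u v * r v)"

text \<open>
  The name \<open>connected\<close> is qualified because it is also used for topological connectedness.
  Connectedness includes that the vertex set is nonempty.
\<close>

definition arithmetical_structure ::
    "'a pair_pre_digraph \<Rightarrow> ('a \<Rightarrow> int) \<Rightarrow> ('a \<Rightarrow> int) \<Rightarrow> bool" where
  "arithmetical_structure G d r \<longleftrightarrow>
     pair_graph G \<and> Digraph_Component.connected (with_proj G) \<and>
     (\<forall>v\<in>pverts G. d v > 0) \<and> (\<forall>v\<in>pverts G. r v > 0) \<and>
     Gcd (r ` pverts G) = 1 \<and>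
     (\<forall>u\<in>pverts G. mat_vec (pverts G) (arith_matrix G d) r u = 0)"

definition path_graph :: "nat \<Rightarrow> nat pair_pre_digraph" where
  "path_graph n = \<lparr> pverts = {1..n}, parcs = (\<Union>i\<in>{1..<n}. {(i, i + 1), (i + 1, i)}) \<rparr>"

text \<open>The Cartesian product of \<open>path_graph n\<close> and \<open>path_graph m\<close>.\<close>

definition grid_graph :: "nat \<Rightarrow> nat \<Rightarrow> (nat \<times> nat) pair_pre_digraph" where
  "grid_graph n m =
     \<lparr> pverts = {1..n} \<times> {1..m},
       parcs = {((i, j), (k, l)) | i j k l.
         (i, j) \<in> {1..n} \<times> {1..m} \<and> (k, l) \<in> {1..n} \<times> {1..m} \<and>
         (i = k \<and> \<bar>int j - int l\<bar> = 1 \<or> j = l \<and> \<bar>int i - int k\<bar> = 1)} \<rparr>"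

lemma grid_graph_arcs_cartesian_product:
  "parcs (grid_graph n m) =
     {((i, j), (k, l)) | i j k l.
        i = k \<and> i \<in> pverts (path_graph n) \<and> (j, l) \<in> parcs (path_graph m) \<or>
        j = l \<and> j \<in> pverts (path_graph m) \<and> (i, k) \<in> parcs (path_graph n)}"
proof -
  have path: "(a, b) \<in> parcs (path_graph p) \<longleftrightarrow> a \<in> {1..p} \<and> b \<in> {1..p} \<and> \<bar>int a - int b\<bar> = 1"
    for a b p :: nat
  proof -
    have "(a, b) \<in> parcs (path_graph p) \<longleftrightarrow> a \<in> {1..p} \<and> b \<in> {1..p} \<and> (b = a + 1 \<or> a = b + 1)"
      by (auto simp: path_graph_def)
    moreover have "\<bar>int a - int b\<bar> = 1 \<longleftrightarrow> b = a + 1 \<or> a = b + 1"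
      by linarith
    ultimately show ?thesis by simp
  qed
  have verts: "pverts (path_graph p) = {1..p}" for p
    by (simp add: path_graph_def)
  show ?thesis
    unfolding path verts by (auto simp: grid_graph_def)
qed

definition kronecker :: "('a \<Rightarrow> int) \<Rightarrow> ('b \<Rightarrow> int) \<Rightarrow> 'a \<times> 'b \<Rightarrow> int" (infixl \<open>\<otimes>\<^sub>K\<close> 70) where
  "x \<otimes>\<^sub>K y = (\<lambda>(i, j). x i * y j)"

end

theory Submission
  imports Defs
begin

text \<open>
  The grid is the Cartesian product of two paths, and nothing in the theorem depends on the factors
  being paths.  For graphs \<open>G\<close> and \<open>H\<close> without loops, the matrix of the product with diagonal
  \<open>d\<^sub>G i + d\<^sub>H j\<close> is the Kronecker sum of the matrices of the factors,
  \<open>M = M\<^sub>G \<otimes> I + I \<otimes> M\<^sub>H\<close> (lemma \<open>arith_matrix_cartesian_product\<close>), so that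
  \<open>M (x \<otimes> y) = (M\<^sub>G x) \<otimes> y + x \<otimes> (M\<^sub>H y)\<close> (lemma \<open>mat_vec_cartesian_product\<close>).  Both
  summands vanish when \<open>x\<close> and \<open>y\<close> lie in the kernels of \<open>M\<^sub>G\<close> and \<open>M\<^sub>H\<close>.

  The other requirements on an arithmetical structure pass to the product too: positivity is
  immediate, primitivity holds because the gcd of all products \<open>x i * y j\<close> is the product of the two
  gcds, and a walk in the product from one vertex to another is obtained by first moving the left
  coordinate and then the right one.
\<close>

section \<open>Cartesian products of graphs\<close>

definition cartesian_product ::
    "'a pair_pre_digraph \<Rightarrow> 'b pair_pre_digraph \<Rightarrow> ('a \<times> 'b) pair_pre_digraph" where
  "cartesian_product G H =
     \<lparr> pverts = pverts G \<times> pverts H,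
       parcs = {((i, j), (k, l)) | i j k l.
         i = k \<and> i \<in> pverts G \<and> (j, l) \<in> parcs H \<or>
         j = l \<and> j \<in> pverts H \<and> (i, k) \<in> parcs G} \<rparr>"

lemma pverts_cartesian_product [simp]:
  "pverts (cartesian_product G H) = pverts G \<times> pverts H"
  by (simp add: cartesian_product_def)

lemma parcs_cartesian_product_iff [simp]:
  "((i, j), (k, l)) \<in> parcs (cartesian_product G H) \<longleftrightarrow>
     i = k \<and> i \<in> pverts G \<and> (j, l) \<in> parcs H \<or>
     j = l \<and> j \<in> pverts H \<and> (i, k) \<in> parcs G"
  by (simp add: cartesian_product_def)

lemma grid_graph_eq_cartesian_product:
  "grid_graph n m = cartesian_product (path_graph n) (path_graph m)"
proof -
  have "pverts (grid_graph n m) = pverts (cartesian_product (path_graph n) (path_graph m))"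
    by (simp add: grid_graph_def path_graph_def)
  moreover have "parcs (grid_graph n m) = parcs (cartesian_product (path_graph n) (path_graph m))"
    unfolding grid_graph_arcs_cartesian_product by (simp add: cartesian_product_def)
  ultimately show ?thesis by simp
qed

lemma pair_graph_cartesian_product:
  assumes "pair_graph G" and "pair_graph H"
  shows "pair_graph (cartesian_product G H)"
proof -
  interpret G: pair_graph G by fact
  interpret H: pair_graph H by fact
  let ?P = "cartesian_product G H"
  have wf: "u \<in> pverts ?P \<and> v \<in> pverts ?P \<and> u \<noteq> v \<and> (v, u) \<in> parcs ?P"
    if "(u, v) \<in> parcs ?P" for u v
  proof -
    have loops: "(a, a) \<notin> parcs G" "(b, b) \<notin> parcs H" for a b
      using G.pair_no_loops H.pair_no_loops by fastforce+
    show ?thesis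
      using that loops
      by (cases u; cases v)
        (auto dest: G.in_arcsD1 G.in_arcsD2 H.in_arcsD1 H.in_arcsD2
          G.graph_symmetric H.graph_symmetric)
  qed
  have finite_verts: "finite (pverts ?P)"
    using G.pair_finite_verts H.pair_finite_verts by simp
  have "parcs ?P \<subseteq> pverts ?P \<times> pverts ?P"
    using wf by auto
  then have finite_arcs: "finite (parcs ?P)"
    using finite_verts by (meson finite_SigmaI finite_subset)
  show ?thesis
  proof
    show "fst e \<in> pverts ?P" "snd e \<in> pverts ?P" "fst e \<noteq> snd e" if "e \<in> parcs ?P" for e
      using wf[of "fst e" "snd e"] that by simp_all
    show "symmetric (with_proj ?P)"
      unfolding symmetric_def with_proj_simps using wf by (blast intro: symI)
  qed (fact finite_verts finite_arcs)+
qed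

section \<open>Connectedness of the product\<close>

text \<open>
  Connectedness is defined through the symmetric closure of the arcs.  A graph is symmetric already,
  so it suffices to work with walks along its own arcs.
\<close>

lemma (in pair_graph) connected_iff_strongly_connected:
  "Digraph_Component.connected (with_proj G) \<longleftrightarrow> strongly_connected (with_proj G)"
  unfolding Digraph_Component.connected_def strongly_connected_def
  by (simp add: reachable_mk_symmetric_eq[OF pair_sym_arcs])

lemma reachable_cartesian_product_left:
  assumes "i \<rightarrow>\<^sup>*\<^bsub>with_proj G\<^esub> k" and "j \<in> pverts H"
  shows "(i, j) \<rightarrow>\<^sup>*\<^bsub>with_proj (cartesian_product G H)\<^esub> (k, j)"
  using assms(1) unfolding reachable_def with_proj_simps
proof (induction rule: rtrancl_on_induct)
  case base
  then show ?case using assms(2) by simp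
next
  case (step k l)
  then show ?case
    using assms(2) by (intro rtrancl_on_into_rtrancl_on[OF step.IH]) auto
qed

lemma reachable_cartesian_product_right:
  assumes "j \<rightarrow>\<^sup>*\<^bsub>with_proj H\<^esub> l" and "i \<in> pverts G"
  shows "(i, j) \<rightarrow>\<^sup>*\<^bsub>with_proj (cartesian_product G H)\<^esub> (i, l)"
  using assms(1) unfolding reachable_def with_proj_simps
proof (induction rule: rtrancl_on_induct)
  case base
  then show ?case using assms(2) by simp
next
  case (step k l)
  then show ?case
    using assms(2) by (intro rtrancl_on_into_rtrancl_on[OF step.IH]) auto
qed

lemma connected_cartesian_product:
  assumes "pair_graph G" and "pair_graph H"
    and "Digraph_Component.connected (with_proj G)"
    and "Digraph_Component.connected (with_proj H)"
  shows "Digraph_Component.connected (with_proj (cartesian_product G H))"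
proof -
  interpret P: pair_graph "cartesian_product G H"
    using assms(1,2) by (rule pair_graph_cartesian_product)
  have G: "strongly_connected (with_proj G)" and H: "strongly_connected (with_proj H)"
    using assms pair_graph.connected_iff_strongly_connected by blast+
  show ?thesis
    unfolding P.connected_iff_strongly_connected
  proof (rule strongly_connectedI)
    show "verts (with_proj (cartesian_product G H)) \<noteq> {}"
      using G H by (auto simp: strongly_connected_def)
  next
    fix u v
    assume "u \<in> verts (with_proj (cartesian_product G H))"
      and "v \<in> verts (with_proj (cartesian_product G H))"
    then obtain i j k l where uv: "u = (i, j)" "v = (k, l)"
      and mem: "i \<in> pverts G" "k \<in> pverts G" "j \<in> pverts H" "l \<in> pverts H"
      by auto
    have "(i, j) \<rightarrow>\<^sup>*\<^bsub>with_proj (cartesian_product G H)\<^esub> (k, j)"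
      using G mem by (intro reachable_cartesian_product_left) auto
    moreover have "(k, j) \<rightarrow>\<^sup>*\<^bsub>with_proj (cartesian_product G H)\<^esub> (k, l)"
      using H mem by (intro reachable_cartesian_product_right) auto
    ultimately show "u \<rightarrow>\<^sup>*\<^bsub>with_proj (cartesian_product G H)\<^esub> v"
      unfolding uv by (rule P.reachable_trans)
  qed
qed

section \<open>The matrix of the product\<close>

text \<open>
  The entry of \<open>M\<^sub>G \<otimes> I + I \<otimes> M\<^sub>H\<close> at \<open>((i, j), (k, l))\<close>.  On the diagonal the two matrices
  contribute \<open>dG i\<close> and \<open>dH j\<close> and no adjacency terms, because there are no loops.  Off the
  diagonal, an arc of the product changes exactly one coordinate, so at most one of the two summands
  is nonzero.
\<close>

lemma arith_matrix_cartesian_product: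
  assumes "pair_graph G" and "pair_graph H"
    and "i \<in> pverts G" and "j \<in> pverts H"
    and "d (i, j) = dG i + dH j"
  shows "arith_matrix (cartesian_product G H) d (i, j) (k, l) =
    arith_matrix G dG i k * (if j = l then 1 else 0) +
    (if i = k then 1 else 0) * arith_matrix H dH j l"
proof -
  interpret G: pair_graph G by fact
  interpret H: pair_graph H by fact
  have "(a, a) \<notin> parcs G" "(b, b) \<notin> parcs H" for a b
    using G.pair_no_loops H.pair_no_loops by fastforce+
  then show ?thesis
    using assms(3-5) by (auto simp: arith_matrix_def diag_def adjacency_matrix_def)
qed

text \<open>
  In the double sum over the vertices \<open>(k, l)\<close> of the product, the entries of the two identity
  matrices collapse the sum over \<open>l\<close> in the first summand and the sum over \<open>k\<close> in the second.
\<close>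

lemma mat_vec_cartesian_product:
  assumes G: "pair_graph G" and H: "pair_graph H"
    and i: "i \<in> pverts G" and j: "j \<in> pverts H"
    and d: "d (i, j) = dG i + dH j"
  shows "mat_vec (pverts (cartesian_product G H)) (arith_matrix (cartesian_product G H) d)
      (x \<otimes>\<^sub>K y) (i, j) =
    mat_vec (pverts G) (arith_matrix G dG) x i * y j +
    x i * mat_vec (pverts H) (arith_matrix H dH) y j"
proof -
  interpret G: pair_graph G by fact
  interpret H: pair_graph H by fact
  note fin = G.pair_finite_verts H.pair_finite_verts
  let ?A = "arith_matrix G dG i" and ?B = "arith_matrix H dH j"
  have "mat_vec (pverts (cartesian_product G H)) (arith_matrix (cartesian_product G H) d)
      (x \<otimes>\<^sub>K y) (i, j) =
    (\<Sum>k\<in>pverts G. \<Sum>l\<in>pverts H.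
      arith_matrix (cartesian_product G H) d (i, j) (k, l) * (x k * y l))"
    by (simp add: mat_vec_def kronecker_def sum.cartesian_product case_prod_beta)
  also have "\<dots> = (\<Sum>k\<in>pverts G. \<Sum>l\<in>pverts H.
      (if j = l then ?A k * x k * y l else 0) + (if i = k then x k * (?B l * y l) else 0))"
    by (intro sum.cong refl)
      (simp add: arith_matrix_cartesian_product[where d = d and dG = dG and dH = dH, OF G H i j d]
        algebra_simps)
  also have "\<dots> = (\<Sum>k\<in>pverts G. \<Sum>l\<in>pverts H. if j = l then ?A k * x k * y l else 0) +
      (\<Sum>l\<in>pverts H. \<Sum>k\<in>pverts G. if i = k then x k * (?B l * y l) else 0)"
    by (simp only: sum.distrib) (simp only: sum.swap[of _ "pverts H" "pverts G"])
  also have "\<dots> = (\<Sum>k\<in>pverts G. ?A k * x k * y j) + (\<Sum>l\<in>pverts H. x i * (?B l * y l))"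
    using fin i j by simp
  finally show ?thesis
    by (simp add: mat_vec_def sum_distrib_left sum_distrib_right)
qed

section \<open>Primitivity and the product structure\<close>

lemma kronecker_image: "(x \<otimes>\<^sub>K y) ` (A \<times> B) = (\<Union>i\<in>A. (*) (x i) ` y ` B)"
  by (auto simp: kronecker_def image_iff)

text \<open>
  Fixing \<open>i\<close>, a common divisor \<open>g\<close> of all \<open>x i * y j\<close> divides
  \<open>Gcd {x i * y j | j} = \<bar>x i\<bar>\<close>; letting \<open>i\<close> vary, \<open>g\<close> divides \<open>Gcd {x i | i} = 1\<close>.
\<close>

lemma Gcd_kronecker_eq_1:
  assumes "Gcd (x ` A) = 1" and "Gcd (y ` B) = 1"
  shows "Gcd ((x \<otimes>\<^sub>K y) ` (A \<times> B)) = 1"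
proof -
  let ?g = "Gcd ((x \<otimes>\<^sub>K y) ` (A \<times> B))"
  have "?g dvd x i" if "i \<in> A" for i
  proof -
    have "?g dvd Gcd ((*) (x i) ` y ` B)"
      unfolding kronecker_image using that by (intro Gcd_greatest Gcd_dvd) blast
    then show ?thesis
      unfolding Gcd_mult using assms(2) by simp
  qed
  then have "?g dvd Gcd (x ` A)"
    by (auto intro: Gcd_greatest)
  then show ?thesis
    using assms(1) by simp
qed

theorem arithmetical_structure_cartesian_product:
  assumes G: "arithmetical_structure G dG x" and H: "arithmetical_structure H dH y"
    and d: "\<And>i j. i \<in> pverts G \<Longrightarrow> j \<in> pverts H \<Longrightarrow> d (i, j) = dG i + dH j"
  shows "arithmetical_structure (cartesian_product G H) d (x \<otimes>\<^sub>K y)"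
proof -
  have graphs: "pair_graph G" "pair_graph H"
    using G H by (auto simp: arithmetical_structure_def)
  have "mat_vec (pverts (cartesian_product G H)) (arith_matrix (cartesian_product G H) d)
      (x \<otimes>\<^sub>K y) (i, j) = 0" if "i \<in> pverts G" "j \<in> pverts H" for i j
    using G H that
    by (simp add: mat_vec_cartesian_product[where d = d and dG = dG and dH = dH, OF graphs that d[OF that]]
        arithmetical_structure_def del: pverts_cartesian_product)
  moreover have "d (i, j) > 0" "(x \<otimes>\<^sub>K y) (i, j) > 0"
    if "i \<in> pverts G" "j \<in> pverts H" for i j
    using G H that d[OF that] by (auto simp: arithmetical_structure_def kronecker_def add_pos_pos)
  ultimately show ?thesis
    using G H pair_graph_cartesian_product connected_cartesian_product Gcd_kronecker_eq_1
    unfolding arithmetical_structure_def by auto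
qed

theorem theorem4p15:
  fixes n m :: nat
    and dn x dm y :: "nat \<Rightarrow> int"
    and d r :: "nat \<times> nat \<Rightarrow> int"
  assumes "arithmetical_structure (path_graph n) dn x"
    and "arithmetical_structure (path_graph m) dm y"
    and "r = x \<otimes>\<^sub>K y"
    and "\<And>i j. i \<in> {1..n} \<Longrightarrow> j \<in> {1..m} \<Longrightarrow> d (i, j) = dn i + dm j"
  shows "arithmetical_structure (grid_graph n m) d r \<and>
    (\<forall>u\<in>pverts (grid_graph n m).
       mat_vec (pverts (grid_graph n m)) (arith_matrix (grid_graph n m) d) r u = 0)"
proof -
  have "arithmetical_structure (grid_graph n m) d r"
    unfolding grid_graph_eq_cartesian_product assms(3)
    using assms(4)
    by (intro arithmetical_structure_cartesian_product[OF assms(1,2)]) (auto simp: path_graph_def)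
  then show ?thesis
    by (simp add: arithmetical_structure_def)
qed

end
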